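(* Let $\mathcal{A}$ be any alphabet set (a discrete set, finite or infinite, or a metric space $(\mathcal{A},d)$), let $(\Omega,\sigma)$ be a subshift of $(\mathcal{A}^{\mathbb{N}},\sigma)$, and let $\overline{\sigma}$ be the induced map on the hyperspace $\mathcal{K}(\Omega)$ of nonempty compact subsets of $\Omega$. Then $(\Omega,\sigma)$ is topologically mixing if and only if $(\mathcal{K}(\Omega),\overline{\sigma})$ is topologically mixing.
   Context: Sequences are indexed from $0$ and $\sigma(x_0x_1x_2\ldots)=x_1x_2x_3\ldots$. A subshift of $\mathcal{A}^{\mathbb{N}}$ is a nonempty closed subset $\Omega$ with $\sigma(\Omega)\subseteq\Omega$. The space $\mathcal{A}^{\mathbb{N}}$ carries the metric $D$, where $D(\bar x,\bar y)=\sum_{i=0}^\infty \frac{\delta(x_i,y_i)}{2^i}$ ($\delta$ the discrete metric) if $\mathcal{A}$ is a discrete alphabet, and $D(\bar x,\bar y)=\sum_{i=0}^\infty \frac{1}{2^i}\frac{d(x_i,y_i)}{1+d(x_i,y_i)}$ if $\mathcal{A}$ is a general metric space. $\mathcal{K}(\Omega)$ carries the Hausdorff metric $D_H$ induced by $D$, and $\overline{\sigma}(K)=\sigma(K)$. A continuous $f:X\to X$ is topologically mixing if for any nonempty open $U,V\subseteq X$ there is a positive integer $k$ with $f^n(U)\cap V\neq\emptyset$ for all $n\ge k$. *)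

theory Defs
  imports "HOL-Analysis.Analysis"
begin

definition seq_space :: "'a set \<Rightarrow> (nat \<Rightarrow> 'a) set" where
  "seq_space A = {x. range x \<subseteq> A}"

definition shift :: "(nat \<Rightarrow> 'a) \<Rightarrow> nat \<Rightarrow> 'a" where
  "shift x = (\<lambda>i. x (Suc i))"

definition seq_dist_discrete :: "(nat \<Rightarrow> 'a) \<Rightarrow> (nat \<Rightarrow> 'a) \<Rightarrow> real" where
  "seq_dist_discrete x y = (\<Sum>i. discrete_metric.dd (x i) (y i) / 2 ^ i)"

definition seq_dist_metric ::
    "('a \<Rightarrow> 'a \<Rightarrow> real) \<Rightarrow> (nat \<Rightarrow> 'a) \<Rightarrow> (nat \<Rightarrow> 'a) \<Rightarrow> real" where
  "seq_dist_metric d x y = (\<Sum>i. 1 / 2 ^ i * (d (x i) (y i) / (1 + d (x i) (y i))))"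

text \<open>The two kinds of alphabet: a discrete set \<open>A\<close> of any cardinality, and a metric
  space \<open>(A, d)\<close>. The discrete case is not the second one with the discrete metric for \<open>d\<close>,
  which would give half of \<^const>\<open>seq_dist_discrete\<close>.\<close>

definition alphabet_seq_dist ::
    "'a set \<Rightarrow> ((nat \<Rightarrow> 'a) \<Rightarrow> (nat \<Rightarrow> 'a) \<Rightarrow> real) \<Rightarrow> bool" where
  "alphabet_seq_dist A D \<longleftrightarrow>
     D = seq_dist_discrete \<or> (\<exists>d. Metric_space A d \<and> D = seq_dist_metric d)"

definition subshift ::
    "'a set \<Rightarrow> ((nat \<Rightarrow> 'a) \<Rightarrow> (nat \<Rightarrow> 'a) \<Rightarrow> real) \<Rightarrow> (nat \<Rightarrow> 'a) set \<Rightarrow> bool" where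
  "subshift A D \<Omega> \<longleftrightarrow>
     \<Omega> \<noteq> {} \<and> closedin (Metric_space.mtopology (seq_space A) D) \<Omega> \<and> shift ` \<Omega> \<subseteq> \<Omega>"

definition hyperspace :: "'b set \<Rightarrow> ('b \<Rightarrow> 'b \<Rightarrow> real) \<Rightarrow> 'b set set" where
  "hyperspace M d = {K. K \<noteq> {} \<and> compactin (Metric_space.mtopology M d) K}"

text \<open>As for \<^const>\<open>infdist\<close>, the value at the empty set is \<open>0\<close> by convention; the empty set
  is not a point of the hyperspace. For bounded \<open>d\<close> this makes the function nonnegative
  everywhere, as \<^locale>\<open>Metric_space\<close> demands.\<close>

definition hausdorff_dist :: "('b \<Rightarrow> 'b \<Rightarrow> real) \<Rightarrow> 'b set \<Rightarrow> 'b set \<Rightarrow> real" where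
  "hausdorff_dist d K L =
     (if K = {} \<or> L = {} then 0
      else max (SUP x\<in>K. INF y\<in>L. d x y) (SUP y\<in>L. INF x\<in>K. d x y))"

definition induced_map :: "('b \<Rightarrow> 'b) \<Rightarrow> 'b set \<Rightarrow> 'b set" where
  "induced_map f K = f ` K"

definition topologically_mixing :: "'b topology \<Rightarrow> ('b \<Rightarrow> 'b) \<Rightarrow> bool" where
  "topologically_mixing X f \<longleftrightarrow>
     continuous_map X X f \<and>
     (\<forall>U V. openin X U \<and> U \<noteq> {} \<and> openin X V \<and> V \<noteq> {} \<longrightarrow>
        (\<exists>k>0. \<forall>n\<ge>k. (f ^^ n) ` U \<inter> V \<noteq> {}))"

text \<open>The distances above are metrics on the respective carriers.\<close>

lemma weighted_sum_metric:
  fixes e :: "'a \<Rightarrow> 'a \<Rightarrow> real"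
  assumes "Metric_space A e" and le1: "\<And>a b. e a b \<le> 1"
  defines "D \<equiv> \<lambda>x y. \<Sum>i. e (x i) (y i) / 2 ^ i"
  shows "Metric_space (seq_space A) D" and "D x y \<le> 2"
proof -
  interpret Metric_space A e by fact
  have geo: "summable (\<lambda>i. 1 / 2 ^ i :: real)"
    using summable_geometric[of "1/2::real"] by (simp add: power_one_over)
  have sm: "summable (\<lambda>i. e (x i) (y i) / 2 ^ i)" for x y
    by (rule summable_comparison_test'[OF geo, of 0]) (simp add: le1 divide_right_mono)
  show "D x y \<le> 2"
  proof -
    have "D x y \<le> (\<Sum>i. 1 / 2 ^ i :: real)"
      unfolding D_def by (intro suminf_le sm geo) (simp add: le1 divide_right_mono)
    also have "\<dots> = 2"
      using suminf_geometric[of "1/2::real"] by (simp add: power_one_over)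
    finally show ?thesis .
  qed
  show "Metric_space (seq_space A) D"
  proof
    show "0 \<le> D x y" for x y
      unfolding D_def by (intro suminf_nonneg sm) simp
    show "D x y = D y x" for x y
      unfolding D_def by (simp add: commute)
    show "D x y = 0 \<longleftrightarrow> x = y" if "x \<in> seq_space A" "y \<in> seq_space A" for x y
    proof -
      have "D x y = 0 \<longleftrightarrow> (\<forall>i. e (x i) (y i) / 2 ^ i = 0)"
        unfolding D_def by (intro suminf_eq_zero_iff sm) simp
      also have "\<dots> \<longleftrightarrow> x = y"
      proof -
        have "x i \<in> A" "y i \<in> A" for i
          using that by (auto simp: seq_space_def)
        then show ?thesis by (auto simp: fun_eq_iff)
      qed
      finally show ?thesis .
    qed
    show "D x z \<le> D x y + D y z"
      if "x \<in> seq_space A" "y \<in> seq_space A" "z \<in> seq_space A" for x y z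
    proof -
      have "e (x i) (z i) / 2 ^ i \<le> e (x i) (y i) / 2 ^ i + e (y i) (z i) / 2 ^ i" for i
      proof -
        have "e (x i) (z i) \<le> e (x i) (y i) + e (y i) (z i)"
          using that by (intro triangle) (auto simp: seq_space_def)
        then show ?thesis
          by (simp add: add_divide_distrib[symmetric] divide_right_mono)
      qed
      then show ?thesis
        unfolding D_def suminf_add[OF sm sm] by (intro suminf_le sm summable_add)
    qed
  qed
qed

lemma Metric_space_bounded_transform:
  assumes "Metric_space A d"
  shows "Metric_space A (\<lambda>a b. d a b / (1 + d a b))"
proof -
  interpret Metric_space A d by fact
  show ?thesis
  proof
    show "0 \<le> d a b / (1 + d a b)" for a b by simp
    show "d a b / (1 + d a b) = d b a / (1 + d b a)" for a b by (simp add: commute)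
    show "d a b / (1 + d a b) = 0 \<longleftrightarrow> a = b" if "a \<in> A" "b \<in> A" for a b
    proof -
      have "1 + d a b \<noteq> 0" using nonneg[of a b] by linarith
      then show ?thesis using that by simp
    qed
    show "d a c / (1 + d a c) \<le> d a b / (1 + d a b) + d b c / (1 + d b c)"
      if "a \<in> A" "b \<in> A" "c \<in> A" for a b c
    proof -
      have mono: "s / (1 + s) \<le> t / (1 + t)" if "0 \<le> s" "s \<le> t" for s t :: real
        using that by (simp add: divide_simps algebra_simps)
      have "d a c / (1 + d a c) \<le> (d a b + d b c) / (1 + (d a b + d b c))"
        using that by (intro mono triangle) auto
      also have "\<dots> = d a b / (1 + (d a b + d b c)) + d b c / (1 + (d a b + d b c))"
        by (rule add_divide_distrib)
      also have "\<dots> \<le> d a b / (1 + d a b) + d b c / (1 + d b c)"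
        by (intro add_mono divide_left_mono mult_pos_pos)
          (use nonneg[of a b] nonneg[of b c] in linarith)+
      finally show ?thesis .
    qed
  qed
qed

lemma alphabet_seq_dist_metric:
  assumes "alphabet_seq_dist A D"
  shows "Metric_space (seq_space A) D" and "D x y \<le> 2"
proof -
  obtain e where e: "Metric_space A e" "\<And>a b. e a b \<le> 1"
    and D: "D = (\<lambda>x y. \<Sum>i. e (x i) (y i) / 2 ^ i)"
    using assms unfolding alphabet_seq_dist_def
  proof (elim disjE exE conjE)
    assume "D = seq_dist_discrete"
    then show thesis
      by (intro that[of discrete_metric.dd] metric_M_dd)
        (auto simp: fun_eq_iff seq_dist_discrete_def discrete_metric.dd_def)
  next
    fix d assume d: "Metric_space A d" and D: "D = seq_dist_metric d"
    have "d a b / (1 + d a b) \<le> 1" for a b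
      using Metric_space.nonneg[OF d, of a b] by simp
    with D show thesis
      by (intro that[of "\<lambda>a b. d a b / (1 + d a b)"] Metric_space_bounded_transform d)
        (auto simp: fun_eq_iff seq_dist_metric_def mult.commute)
  qed
  show "Metric_space (seq_space A) D" "D x y \<le> 2"
    unfolding D by (fact weighted_sum_metric[OF e])+
qed

lemma hausdorff_dist_metric:
  assumes "Metric_space M d" and bound: "\<And>x y. d x y \<le> B"
  shows "Metric_space (hyperspace M d) (hausdorff_dist d)"
proof -
  interpret Metric_space M d by fact
  define p where "p x L = (INF y\<in>L. d x y)" for x L
  define h where "h K L = (SUP x\<in>K. p x L)" for K L
  have bb: "bdd_below (d x ` L)" for x L by (rule bdd_belowI[of _ 0]) auto
  have p0: "0 \<le> p x L" if "L \<noteq> {}" for x L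
    unfolding p_def using that by (intro cINF_greatest) auto
  have pd: "p x L \<le> d x y" if "y \<in> L" for x y L
    unfolding p_def using that by (intro cINF_lower bb)
  have pB: "p x L \<le> B" if "L \<noteq> {}" for x L
    using that pd bound order_trans by blast
  have ba: "bdd_above ((\<lambda>x. p x L) ` K)" if "L \<noteq> {}" for K L
    using pB[OF that] by (intro bdd_aboveI[of _ B]) auto
  have ph: "p x L \<le> h K L" if "x \<in> K" "L \<noteq> {}" for x K L
    unfolding h_def using that by (intro cSUP_upper ba)
  have h0: "0 \<le> h K L" if "K \<noteq> {}" "L \<noteq> {}" for K L
    using that p0 ph order_trans by (metis ex_in_conv)
  have H: "hausdorff_dist d K L = max (h K L) (h L K)" if "K \<noteq> {}" "L \<noteq> {}" for K L
    using that by (simp add: hausdorff_dist_def h_def p_def commute)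
  have near: "\<exists>y\<in>L. d x y < p x L + r" if "L \<noteq> {}" "r > 0" for x L r
  proof -
    have "Inf (d x ` L) < p x L + r" using that by (simp add: p_def)
    then show ?thesis using that cInf_lessD[of "d x ` L"] by blast
  qed
  have tri: "h K N \<le> h K L + h L N"
    if ne: "K \<noteq> {}" "L \<noteq> {}" "N \<noteq> {}" and sub: "K \<subseteq> M" "L \<subseteq> M" "N \<subseteq> M" for K L N
    unfolding h_def[of K N]
  proof (rule cSUP_least[OF ne(1)])
    fix x assume x: "x \<in> K"
    show "p x N \<le> h K L + h L N"
    proof (rule field_le_epsilon)
      fix r :: real assume "r > 0"
      then have r: "r / 2 > 0" by simp
      obtain y where y: "y \<in> L" "d x y < p x L + r / 2" using near[OF ne(2) r] by blast
      obtain z where z: "z \<in> N" "d y z < p y N + r / 2" using near[OF ne(3) r] by blast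
      have "d x z \<le> d x y + d y z" using x y z sub by (intro triangle) auto
      with pd[OF z(1), of x] y(2) z(2) ph[OF x ne(2)] ph[OF y(1) ne(3)]
      show "p x N \<le> h K L + h L N + r" by linarith
    qed
  qed
  have sub0: "K \<subseteq> L" if ne: "K \<noteq> {}" "L \<noteq> {}" and "h K L = 0" "K \<subseteq> M" and cl: "closedin mtopology L"
    for K L
  proof
    fix x assume x: "x \<in> K"
    have "p x L = 0" using ph[OF x ne(2)] p0[OF ne(2)] that by (simp add: antisym)
    then have "\<exists>y\<in>L. y \<in> mball x r" if "r > 0" for r
      using near[OF ne(2) that, of x] x \<open>K \<subseteq> M\<close> closedin_subset[OF cl] by auto
    then have "x \<in> mtopology closure_of L"
      using x \<open>K \<subseteq> M\<close> by (auto simp: metric_closure_of)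
    then show "x \<in> L" using cl by (simp add: closure_of_closedin)
  qed
  have KD: "K \<noteq> {}" "K \<subseteq> M" "closedin mtopology K" if "K \<in> hyperspace M d" for K
    using that compactin_subset_topspace compactin_imp_closedin[OF Hausdorff_space_mtopology]
    by (fastforce simp: hyperspace_def)+
  show ?thesis
  proof
    show "0 \<le> hausdorff_dist d K L" for K L
    proof (cases "K = {} \<or> L = {}")
      case False
      then show ?thesis using h0 by (simp add: H le_max_iff_disj)
    qed (auto simp: hausdorff_dist_def)
    show "hausdorff_dist d K L = hausdorff_dist d L K" for K L
      by (cases "K = {} \<or> L = {}") (auto simp: H max.commute, auto simp: hausdorff_dist_def)
    show "hausdorff_dist d K L = 0 \<longleftrightarrow> K = L"
      if "K \<in> hyperspace M d" "L \<in> hyperspace M d" for K L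
    proof
      note K = KD[OF that(1)] and L = KD[OF that(2)]
      assume "hausdorff_dist d K L = 0"
      with h0[OF K(1) L(1)] h0[OF L(1) K(1)] have "h K L = 0" "h L K = 0"
        by (auto simp: H[OF K(1) L(1)] max_def split: if_splits)
      then show "K = L" using sub0 K L by blast
    next
      note K = KD[OF that(1)]
      assume "K = L"
      moreover have "h K K = 0"
      proof (rule antisym)
        show "h K K \<le> 0" unfolding h_def
        proof (rule cSUP_least[OF K(1)])
          fix x assume "x \<in> K"
          then show "p x K \<le> 0" using pd[of x K x] K(2) by (auto simp: subset_iff)
        qed
      qed (rule h0[OF K(1) K(1)])
      ultimately show "hausdorff_dist d K L = 0" using K by (simp add: H)
    qed
    show "hausdorff_dist d K N \<le> hausdorff_dist d K L + hausdorff_dist d L N"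
      if "K \<in> hyperspace M d" "L \<in> hyperspace M d" "N \<in> hyperspace M d" for K L N
    proof -
      note K = KD[OF that(1)] and L = KD[OF that(2)] and N = KD[OF that(3)]
      show ?thesis
        using tri[OF K(1) L(1) N(1) K(2) L(2) N(2)] tri[OF N(1) L(1) K(1) N(2) L(2) K(2)]
        by (auto simp: H K L N max_def)
    qed
  qed
qed

end

theory Submission
  imports Defs
begin

text \<open>
  Both directions hold for a continuous map \<open>f\<close> of any bounded metric space. If \<open>f\<close> is mixing,
  approximate compact sets \<open>K\<close> and \<open>L\<close> by finite nets \<open>P \<subseteq> K\<close> and \<open>Q \<subseteq> L\<close>; for all large \<open>n\<close>
  and all \<open>(p, q) \<in> P \<times> Q\<close> simultaneously there is a point \<open>z\<^bsub>p,q\<^esub>\<close> near \<open>p\<close> whose image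
  under \<open>f\<^sup>n\<close> is near \<open>q\<close>, and the finite set of these points is near \<open>K\<close> while its image is
  near \<open>L\<close>. Conversely, apply mixing of the induced map to balls around singletons.
  The shift is Lipschitz with constant \<open>2\<close>.
\<close>

section \<open>Iterates of the induced map and estimates for the Hausdorff distance\<close>

lemma funpow_induced_map: "(induced_map f ^^ n) K = (f ^^ n) ` K"
  by (induction n) (auto simp: induced_map_def)

text \<open>The bound is imposed on all arguments, not only on points of \<open>M\<close>, so the
  suprema in \<open>hausdorff_dist\<close> are bounded above for arbitrary sets.\<close>

locale bounded_Metric_space = Metric_space +
  fixes B :: real
  assumes dist_le: "d x y \<le> B"
begin

lemma Metric_space_hyperspace: "Metric_space (hyperspace M d) (hausdorff_dist d)"
  using hausdorff_dist_metric[OF Metric_space_axioms dist_le] .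

lemma hyperspaceD:
  assumes "K \<in> hyperspace M d"
  shows "K \<noteq> {}" "compactin mtopology K" "K \<subseteq> M"
  using assms compactin_subset_topspace[of mtopology K] by (auto simp: hyperspace_def)

lemma finite_in_hyperspace: "finite F \<Longrightarrow> F \<noteq> {} \<Longrightarrow> F \<subseteq> M \<Longrightarrow> F \<in> hyperspace M d"
  by (simp add: hyperspace_def finite_imp_compactin)

lemma hausdorff_dist_commute: "hausdorff_dist d K L = hausdorff_dist d L K"
  by (simp add: hausdorff_dist_def commute max.commute)

text \<open>Boundedness makes the infimum for \<open>x\<close> at most the supremum over
  \<open>K\<close>, hence below \<open>r\<close>. The strict inequality then supplies a witness even
  if the infimum is not attained, so compactness does not enter.\<close>

lemma hausdorff_dist_lessD:
  assumes less: "hausdorff_dist d K L < r" and x: "x \<in> K" and L: "L \<noteq> {}"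
  shows "\<exists>y\<in>L. d x y < r"
proof -
  have bb: "bdd_below (d u ` L)" for u
    by (rule bdd_belowI[of _ 0]) auto
  have "(INF y\<in>L. d u y) \<le> B" for u
  proof -
    obtain y where "y \<in> L" using L by blast
    then show ?thesis
      using cINF_lower[OF bb \<open>y \<in> L\<close>, of u] dist_le[of u y] by linarith
  qed
  then have "bdd_above ((\<lambda>u. INF y\<in>L. d u y) ` K)"
    by (intro bdd_aboveI[of _ B]) auto
  then have "(INF y\<in>L. d x y) \<le> (SUP u\<in>K. INF y\<in>L. d u y)"
    using x by (rule cSUP_upper[rotated])
  also have "\<dots> < r"
    using less x L unfolding hausdorff_dist_def by (auto split: if_splits)
  finally show ?thesis
    using L bb by (subst (asm) cINF_less_iff) auto
qed

text \<open>A supremum of values below \<open>r\<close> may equal \<open>r\<close>, hence the weak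
  inequalities. Strict bounds are recovered later by applying this with a smaller radius.\<close>

lemma hausdorff_dist_le:
  assumes ne: "K \<noteq> {}" "L \<noteq> {}"
    and KL: "\<And>x. x \<in> K \<Longrightarrow> \<exists>y\<in>L. d x y \<le> r"
    and LK: "\<And>y. y \<in> L \<Longrightarrow> \<exists>x\<in>K. d x y \<le> r"
  shows "hausdorff_dist d K L \<le> r"
proof -
  have bb: "bdd_below ((\<lambda>y. d u y) ` S)" "bdd_below ((\<lambda>y. d y u) ` S)" for u S
    by (auto intro!: bdd_belowI[of _ 0])
  have "(SUP x\<in>K. INF y\<in>L. d x y) \<le> r"
    by (intro cSUP_least ne) (blast dest: KL intro: cINF_lower2[OF bb(1)])
  moreover have "(SUP y\<in>L. INF x\<in>K. d x y) \<le> r"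
    by (intro cSUP_least ne) (blast dest: LK intro: cINF_lower2[OF bb(2)])
  ultimately show ?thesis
    using ne by (simp add: hausdorff_dist_def)
qed

section \<open>Continuity of the induced map\<close>

lemma induced_map_in_hyperspace:
  assumes "continuous_map mtopology mtopology f" "K \<in> hyperspace M d"
  shows "induced_map f K \<in> hyperspace M d"
  using assms image_compactin by (auto simp: hyperspace_def induced_map_def)

text \<open>Only \<open>x\<close> is confined to the compact set; \<open>y\<close> ranges over all
  of \<open>M\<close>, as comparing \<open>K\<close> with a nearby \<open>L\<close> requires. A
  Lebesgue number for the cover of \<open>K\<close> by preimages of balls of radius
  \<open>r / 2\<close> serves as \<open>s\<close>: the images of \<open>x\<close> and
  \<open>y\<close> then lie in one such ball.\<close>

lemma compactin_uniform_continuity: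
  assumes f: "continuous_map mtopology mtopology f"
    and K: "compactin mtopology K" and "0 < r"
  obtains s where "0 < s" "\<And>x y. x \<in> K \<Longrightarrow> y \<in> M \<Longrightarrow> d x y < s \<Longrightarrow> d (f x) (f y) < r"
proof -
  define C where "C = (\<lambda>z. {u \<in> M. f u \<in> mball (f z) (r / 2)}) ` K"
  have KM: "K \<subseteq> M"
    using compactin_subset_topspace[OF K] by simp
  have fM: "f u \<in> M" if "u \<in> M" for u
    using continuous_map_image_subset_topspace[OF f] that by auto
  have "K \<subseteq> \<Union>C"
    using KM fM \<open>0 < r\<close> by (fastforce simp: C_def)
  moreover have "openin mtopology U" if "U \<in> C" for U
    using that openin_continuous_map_preimage[OF f openin_mball]
    by (auto simp: C_def simp del: in_mball)
  ultimately obtain s where s: "0 < s" "\<And>x. x \<in> K \<Longrightarrow> \<exists>U\<in>C. mball x s \<subseteq> U"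
    using lebesgue_number[OF K] by metis
  show thesis
  proof (rule that[OF s(1)])
    fix x y assume x: "x \<in> K" and y: "y \<in> M" "d x y < s"
    obtain z where "z \<in> K" and z: "mball x s \<subseteq> {u \<in> M. f u \<in> mball (f z) (r / 2)}"
      using s(2)[OF x] by (auto simp: C_def)
    moreover have "x \<in> mball x s" "y \<in> mball x s"
      using x y s(1) KM by auto
    ultimately have "f x \<in> mball (f z) (r / 2)" "f y \<in> mball (f z) (r / 2)"
      by blast+
    then have "d (f z) (f x) < r / 2" "d (f z) (f y) < r / 2"
      by simp_all
    moreover have "d (f x) (f y) \<le> d (f z) (f x) + d (f z) (f y)"
      using triangle[of "f x" "f z" "f y"] x y \<open>z \<in> K\<close> KM fM commute[of "f x"] by auto
    ultimately show "d (f x) (f y) < r"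
      by linarith
  qed
qed

lemma continuous_map_induced_map:
  assumes f: "continuous_map mtopology mtopology f"
  defines "\<H> \<equiv> Metric_space.mtopology (hyperspace M d) (hausdorff_dist d)"
  shows "continuous_map \<H> \<H> (induced_map f)"
proof -
  interpret H: Metric_space "hyperspace M d" "hausdorff_dist d"
    by (rule Metric_space_hyperspace)
  have "\<exists>s>0. \<forall>L. L \<in> hyperspace M d \<and> hausdorff_dist d K L < s \<longrightarrow>
          hausdorff_dist d (induced_map f K) (induced_map f L) < r"
    if K: "K \<in> hyperspace M d" and r: "0 < r" for K r
  proof -
    have "0 < r / 2"
      using r by simp
    then obtain s where s: "0 < s"
        "\<And>x y. x \<in> K \<Longrightarrow> y \<in> M \<Longrightarrow> d x y < s \<Longrightarrow> d (f x) (f y) < r / 2"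
      using compactin_uniform_continuity[OF f hyperspaceD(2)[OF K]] by blast
    have "hausdorff_dist d (induced_map f K) (induced_map f L) < r"
      if L: "L \<in> hyperspace M d" and KL: "hausdorff_dist d K L < s" for L
    proof -
      have "hausdorff_dist d (f ` K) (f ` L) \<le> r / 2"
      proof (rule hausdorff_dist_le)
        fix x' assume "x' \<in> f ` K"
        then show "\<exists>y'\<in>f ` L. d x' y' \<le> r / 2"
          using hausdorff_dist_lessD[OF KL] hyperspaceD[OF L] s(2)
          by (fastforce intro: less_imp_le)
      next
        \<comment> \<open>The modulus \<open>s\<close> is uniform only around \<open>K\<close>, so
          the nearby point \<open>x\<close> of \<open>K\<close> must be its first argument here
          too.\<close>
        fix y' assume "y' \<in> f ` L"
        then obtain y where y: "y \<in> L" "y' = f y" by auto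
        obtain x where "x \<in> K" "d y x < s"
          using KL hausdorff_dist_lessD[OF _ y(1)] hyperspaceD(1)[OF K]
          by (metis hausdorff_dist_commute)
        then show "\<exists>x'\<in>f ` K. d x' y' \<le> r / 2"
          using s(2)[of x y] y hyperspaceD(3)[OF L] commute by (auto intro!: less_imp_le)
      qed (use hyperspaceD(1) K L in auto)
      then show ?thesis
        using r by (simp add: induced_map_def)
    qed
    with s(1) show ?thesis by blast
  qed
  then show ?thesis
    using induced_map_in_hyperspace[OF f]
    unfolding \<H>_def H.metric_continuous_map[OF H.Metric_space_axioms] by blast
qed

section \<open>Transfer of mixing between the space and its hyperspace\<close>

theorem topologically_mixing_induced_map:
  assumes mix: "topologically_mixing mtopology f"
  shows "topologically_mixing
    (Metric_space.mtopology (hyperspace M d) (hausdorff_dist d)) (induced_map f)"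
proof -
  interpret H: Metric_space "hyperspace M d" "hausdorff_dist d"
    by (rule Metric_space_hyperspace)
  have f: "continuous_map mtopology mtopology f"
    using mix by (simp add: topologically_mixing_def)
  have fM: "(f ^^ n) u \<in> M" if "u \<in> M" for u n
    using that continuous_map_image_subset_topspace[OF f] by (induction n) auto
  have "\<exists>k>0. \<forall>n\<ge>k. (induced_map f ^^ n) ` \<U> \<inter> \<V> \<noteq> {}"
    if U: "openin H.mtopology \<U>" "\<U> \<noteq> {}" and V: "openin H.mtopology \<V>" "\<V> \<noteq> {}" for \<U> \<V>
  proof -
    obtain K r where K: "K \<in> hyperspace M d" and r: "0 < r" "H.mball K r \<subseteq> \<U>"
      using U unfolding H.openin_mtopology by blast
    obtain L s where L: "L \<in> hyperspace M d" and s: "0 < s" "H.mball L s \<subseteq> \<V>"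
      using V unfolding H.openin_mtopology by blast
    \<comment> \<open>Two errors below \<open>e\<close> add up, one from the net and one from the
      ball around a net point; a third leaves \<open>2 * e\<close> strictly below both
      radii.\<close>
    define e where "e = min r s / 3"
    have e: "0 < e" "2 * e < r" "2 * e < s"
      using r s by (auto simp: e_def min_def)
    obtain P where P: "finite P" "P \<subseteq> K" "K \<subseteq> (\<Union>p\<in>P. mball p e)"
      using compactin_imp_mtotally_bounded[OF hyperspaceD(2)[OF K]] e(1)
      unfolding mtotally_bounded_def by meson
    obtain Q where Q: "finite Q" "Q \<subseteq> L" "L \<subseteq> (\<Union>q\<in>Q. mball q e)"
      using compactin_imp_mtotally_bounded[OF hyperspaceD(2)[OF L]] e(1)
      unfolding mtotally_bounded_def by meson
    have ne: "P \<noteq> {}" "Q \<noteq> {}"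
      using P Q hyperspaceD(1) K L by auto
    have PM: "P \<subseteq> M" and QM: "Q \<subseteq> M"
      using P Q hyperspaceD(3) K L by blast+
    have "\<exists>k>0. \<forall>n\<ge>k. (f ^^ n) ` mball p e \<inter> mball q e \<noteq> {}" if "p \<in> P" "q \<in> Q" for p q
    proof -
      have "p \<in> mball p e" "q \<in> mball q e"
        using that PM QM e by auto
      then show ?thesis
        using mix openin_mball unfolding topologically_mixing_def by blast
    qed
    then obtain k where k: "\<And>p q n. p \<in> P \<Longrightarrow> q \<in> Q \<Longrightarrow> k p q \<le> n \<Longrightarrow>
        (f ^^ n) ` mball p e \<inter> mball q e \<noteq> {}"
      by metis
    \<comment> \<open>The sum of the finitely many thresholds dominates each of them, and
      \<open>Suc\<close> makes \<open>N\<close> positive.\<close>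
    define N where "N = Suc (\<Sum>p\<in>P. \<Sum>q\<in>Q. k p q)"
    have kN: "k p q \<le> N" if "p \<in> P" "q \<in> Q" for p q
    proof -
      have "k p q \<le> (\<Sum>q\<in>Q. k p q)"
        using that Q by (intro member_le_sum) auto
      also have "\<dots> \<le> (\<Sum>p\<in>P. \<Sum>q\<in>Q. k p q)"
        using that P member_le_sum[of p P "\<lambda>p. \<Sum>q\<in>Q. k p q"] by auto
      finally show ?thesis by (simp add: N_def)
    qed
    have "(induced_map f ^^ n) ` \<U> \<inter> \<V> \<noteq> {}" if n: "N \<le> n" for n
    proof -
      have "\<exists>z. z \<in> M \<and> d p z < e \<and> d q ((f ^^ n) z) < e" if "p \<in> P" "q \<in> Q" for p q
        using k[OF that order_trans[OF kN[OF that] n]] by auto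
      then obtain z where z: "\<And>p q. p \<in> P \<Longrightarrow> q \<in> Q \<Longrightarrow>
          z p q \<in> M \<and> d p (z p q) < e \<and> d q ((f ^^ n) (z p q)) < e"
        by metis
      \<comment> \<open>One point per pair: every \<open>p\<close> has a point of \<open>F\<close>
        near it, and every \<open>q\<close> has a point of the image of \<open>F\<close> near
        it.\<close>
      define F where "F = (\<lambda>(p, q). z p q) ` (P \<times> Q)"
      have F: "F \<in> hyperspace M d" "(f ^^ n) ` F \<in> hyperspace M d"
        using P Q ne z fM by (auto simp: F_def intro!: finite_in_hyperspace)
      have net: "\<exists>p\<in>S. d x p < e" if "S' \<subseteq> (\<Union>p\<in>S. mball p e)" "x \<in> S'" for S S' x
        using that commute by fastforce
      have tri: "d x w \<le> 2 * e" if "x \<in> M" "p \<in> M" "w \<in> M" "d x p < e" "d p w < e" for x p w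
        using triangle[of x p w] that by simp
      have "hausdorff_dist d K F \<le> 2 * e"
      proof (rule hausdorff_dist_le)
        fix x assume x: "x \<in> K"
        obtain p where p: "p \<in> P" "d x p < e" using net[OF P(3) x] by blast
        \<comment> \<open>Any \<open>q\<close> will do, since \<open>z p q\<close> is near
          \<open>p\<close> whatever \<open>q\<close> is.\<close>
        obtain q where q: "q \<in> Q" using ne by blast
        have "d x (z p q) \<le> 2 * e"
          using tri[of x p "z p q"] x p z[OF p(1) q] PM hyperspaceD(3)[OF K] by blast
        then show "\<exists>y\<in>F. d x y \<le> 2 * e"
          using p q by (auto simp: F_def)
      next
        fix y assume "y \<in> F"
        then obtain p q where pq: "p \<in> P" "q \<in> Q" "y = z p q"
          by (auto simp: F_def)
        then have "d p y \<le> 2 * e"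
          using z[OF pq(1,2)] e(1) by simp
        then show "\<exists>x\<in>K. d x y \<le> 2 * e"
          using pq(1) P(2) by blast
      qed (use hyperspaceD(1) K F in auto)
      then have "F \<in> \<U>"
        using r(2) K F e by auto
      moreover have "hausdorff_dist d L ((f ^^ n) ` F) \<le> 2 * e"
      proof (rule hausdorff_dist_le)
        fix x assume x: "x \<in> L"
        obtain q where q: "q \<in> Q" "d x q < e" using net[OF Q(3) x] by blast
        obtain p where p: "p \<in> P" using ne by blast
        have "d x ((f ^^ n) (z p q)) \<le> 2 * e"
          using tri[of x q "(f ^^ n) (z p q)"] x q z[OF p q(1)] fM QM hyperspaceD(3)[OF L]
          by blast
        then show "\<exists>y\<in>(f ^^ n) ` F. d x y \<le> 2 * e"
          using p q by (auto simp: F_def)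
      next
        fix y assume "y \<in> (f ^^ n) ` F"
        then obtain p q where pq: "p \<in> P" "q \<in> Q" "y = (f ^^ n) (z p q)"
          by (auto simp: F_def)
        then have "d q y \<le> 2 * e"
          using z[OF pq(1,2)] e(1) by simp
        then show "\<exists>x\<in>L. d x y \<le> 2 * e"
          using pq(2) Q(2) by blast
      qed (use hyperspaceD(1) L F in auto)
      then have "(induced_map f ^^ n) F \<in> \<V>"
        using s(2) L F e by (auto simp: funpow_induced_map)
      ultimately show ?thesis by blast
    qed
    then show ?thesis
      by (intro exI[of _ N]) (auto simp: N_def)
  qed
  then show ?thesis
    using continuous_map_induced_map[OF f] by (simp add: topologically_mixing_def)
qed

text \<open>A set Hausdorff-close to a singleton lies wholly in a ball around its point, so every
  point of a set witnessing mixing in the hyperspace witnesses mixing of \<open>f\<close>.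
  Continuity of \<open>f\<close> is assumed because \<open>topologically_mixing\<close> includes
  it.\<close>

theorem topologically_mixing_if_induced_map:
  assumes f: "continuous_map mtopology mtopology f"
    and mix: "topologically_mixing
      (Metric_space.mtopology (hyperspace M d) (hausdorff_dist d)) (induced_map f)"
  shows "topologically_mixing mtopology f"
proof -
  interpret H: Metric_space "hyperspace M d" "hausdorff_dist d"
    by (rule Metric_space_hyperspace)
  have sing: "{x} \<in> hyperspace M d" if "x \<in> M" for x
    using that by (simp add: finite_in_hyperspace)
  \<comment> \<open>With the singleton as second set, the only possible nearby point is
    \<open>x\<close> itself.\<close>
  have near: "d x y < r" if "K \<in> H.mball {x} r" "y \<in> K" for x y r K
    using that hausdorff_dist_lessD[of K "{x}" r y]
    by (auto simp: hausdorff_dist_commute commute)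
  have "\<exists>k>0. \<forall>n\<ge>k. (f ^^ n) ` U \<inter> V \<noteq> {}"
    if U: "openin mtopology U" "U \<noteq> {}" and V: "openin mtopology V" "V \<noteq> {}" for U V
  proof -
    obtain x r where x: "x \<in> M" "0 < r" "mball x r \<subseteq> U"
      using U unfolding openin_mtopology by blast
    obtain y s where y: "y \<in> M" "0 < s" "mball y s \<subseteq> V"
      using V unfolding openin_mtopology by blast
    have "{x} \<in> H.mball {x} r" "{y} \<in> H.mball {y} s"
      using x y sing by auto
    then obtain k where k: "0 < k"
        "\<And>n. k \<le> n \<Longrightarrow> (induced_map f ^^ n) ` H.mball {x} r \<inter> H.mball {y} s \<noteq> {}"
      using mix H.openin_mball unfolding topologically_mixing_def by (metis empty_iff)
    have "(f ^^ n) ` U \<inter> V \<noteq> {}" if n: "k \<le> n" for n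
    proof -
      obtain K where K: "K \<in> H.mball {x} r" "(f ^^ n) ` K \<in> H.mball {y} s"
        using k(2)[OF n] unfolding funpow_induced_map by blast
      then have "K \<in> hyperspace M d" "(f ^^ n) ` K \<in> hyperspace M d"
        by auto
      then obtain a where a: "a \<in> K" "a \<in> M" "(f ^^ n) a \<in> M"
        using hyperspaceD(1,3) by fast
      then have "a \<in> mball x r" "(f ^^ n) a \<in> mball y s"
        using x y near[OF K(1)] near[OF K(2)] by auto
      then show ?thesis
        using x(3) y(3) by blast
    qed
    with k(1) show ?thesis by blast
  qed
  with f show ?thesis
    by (simp add: topologically_mixing_def)
qed

end

section \<open>The shift on sequences over either kind of alphabet\<close>

lemma alphabet_seq_dist_weighted_sum:
  assumes "alphabet_seq_dist A D"
  obtains e :: "'a \<Rightarrow> 'a \<Rightarrow> real"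
  where "\<And>a b. 0 \<le> e a b" "\<And>a b. e a b \<le> 1" "D = (\<lambda>x y. \<Sum>i. e (x i) (y i) / 2 ^ i)"
  using assms unfolding alphabet_seq_dist_def
proof (elim disjE exE conjE)
  assume "D = seq_dist_discrete"
  then show thesis
    by (intro that[of discrete_metric.dd])
      (auto simp: fun_eq_iff seq_dist_discrete_def discrete_metric.dd_def)
next
  fix d assume d: "Metric_space A d" and D: "D = seq_dist_metric d"
  have "0 \<le> d a b" for a b
    using Metric_space.nonneg[OF d] .
  with D show thesis
    by (intro that[of "\<lambda>a b. d a b / (1 + d a b)"])
      (auto simp: fun_eq_iff seq_dist_metric_def mult.commute divide_le_eq_1 add_nonneg_nonneg
        intro: add_pos_nonneg)
qed

text \<open>Shifting discards the nonnegative term of index 0 and doubles the weight of every other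
  term.\<close>

lemma alphabet_seq_dist_shift_le:
  assumes "alphabet_seq_dist A D"
  shows "D (shift x) (shift y) \<le> 2 * D x y"
proof -
  obtain e where e: "\<And>a b. 0 \<le> e a b" "\<And>a b. e a b \<le> 1"
    and D: "D = (\<lambda>x y. \<Sum>i. e (x i) (y i) / 2 ^ i)"
    using alphabet_seq_dist_weighted_sum[OF assms] by blast
  define g where "g i = e (x i) (y i) / 2 ^ i" for i
  have "summable (\<lambda>i. 1 / 2 ^ i :: real)"
    using summable_geometric[of "1/2::real"] by (simp add: power_one_over)
  then have g: "summable g"
    by (rule summable_comparison_test'[of _ 0]) (simp add: g_def e divide_right_mono)
  have "D (shift x) (shift y) = (\<Sum>i. 2 * g (Suc i))"
    by (simp add: D shift_def g_def)
  also have "\<dots> = 2 * (suminf g - g 0)"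
    using g by (simp add: suminf_mult summable_Suc_iff suminf_split_head)
  also have "\<dots> \<le> 2 * D x y"
    by (simp add: D g_def[abs_def] e)
  finally show ?thesis .
qed

theorem proposition3p11:
  fixes A :: "'a set"
    and D :: "(nat \<Rightarrow> 'a) \<Rightarrow> (nat \<Rightarrow> 'a) \<Rightarrow> real"
    and \<Omega> :: "(nat \<Rightarrow> 'a) set"
  assumes "alphabet_seq_dist A D"
    and "subshift A D \<Omega>"
  shows "topologically_mixing (Metric_space.mtopology \<Omega> D) shift \<longleftrightarrow>
         topologically_mixing
           (Metric_space.mtopology (hyperspace \<Omega> D) (hausdorff_dist D)) (induced_map shift)"
proof -
  interpret S: Metric_space "seq_space A" D
    by (rule alphabet_seq_dist_metric(1)[OF assms(1)])
  have "closedin S.mtopology \<Omega>" and shift: "shift ` \<Omega> \<subseteq> \<Omega>"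
    using assms(2) by (auto simp: subshift_def)
  then have "\<Omega> \<subseteq> seq_space A"
    using closedin_subset by fastforce
  \<comment> \<open>The metric on \<open>\<Omega>\<close> is \<open>D\<close> restricted from
    \<open>seq_space A\<close>, and 2 is the total of the weights \<open>1 / 2 ^ i\<close>.\<close>
  then interpret bounded_Metric_space \<Omega> D 2
    using S.subspace alphabet_seq_dist_metric(2)[OF assms(1)]
    by (simp add: bounded_Metric_space_def bounded_Metric_space_axioms_def)
  have "D (shift x) (shift y) < r" if "D x y < r / 2" for x y r
    using that alphabet_seq_dist_shift_le[OF assms(1), of x y] by linarith
  then have "\<exists>s>0. \<forall>y. y \<in> \<Omega> \<and> D x y < s \<longrightarrow> D (shift x) (shift y) < r" if "0 < r" for x r
    using that half_gt_zero by blast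
  then have "continuous_map mtopology mtopology shift"
    using shift by (simp add: metric_continuous_map[OF Metric_space_axioms])
  then show ?thesis
    using topologically_mixing_induced_map topologically_mixing_if_induced_map by blast
qed

end
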